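(* Let $1\leq p<+\infty$ and $1\leq q\leq+\infty$. If $f\in RM(p,q)$, then $$\rho_{p,q}(f)\leq p\,\rho_{p,q}\big(f'(z)(1-|z|)\big)+|f(0)|.$$
   Context: $\mathbb{D}$ is the open unit disc of $\mathbb{C}$ and $\mathcal{H}(\mathbb{D})$ the space of analytic functions on $\mathbb{D}$. For measurable $h:\mathbb{D}\to\mathbb{C}$ and $1\le p<+\infty$, set $$\rho_{p,q}(h)=\Big(\frac{1}{2\pi}\int_0^{2\pi}\Big(\int_0^1|h(re^{it})|^p\,dr\Big)^{q/p}dt\Big)^{1/q}\ (q<+\infty),\qquad \rho_{p,\infty}(h)=\operatorname{ess\,sup}_{t\in[0,2\pi)}\Big(\int_0^1|h(re^{it})|^p\,dr\Big)^{1/p},$$ with values in $[0,+\infty]$. $RM(p,q)=\{f\in\mathcal{H}(\mathbb{D}):\rho_{p,q}(f)<+\infty\}$. Here $\rho_{p,q}(f'(z)(1-|z|))$ denotes $\rho_{p,q}$ of the function $z\mapsto f'(z)(1-|z|)$. *)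

theory Defs
  imports "HOL-Probability.Essential_Supremum"
begin

text \<open>Powers on \<open>[0, \<infinity>]\<close> with a positive real exponent.\<close>
definition enn_powr :: "ennreal \<Rightarrow> real \<Rightarrow> ennreal" where
  "enn_powr x a = (if x = top then top else ennreal (enn2real x powr a))"

text \<open>The radius runs over \<open>[0, 1)\<close>, so that \<open>h\<close> is only evaluated inside the open unit disc;
  \<^term>\<open>rcis r t\<close> is \<open>r exp (\<i> t)\<close>.\<close>
definition radial_int :: "real \<Rightarrow> (complex \<Rightarrow> complex) \<Rightarrow> real \<Rightarrow> ennreal" where
  "radial_int p h t = (\<integral>\<^sup>+ r. ennreal (cmod (h (rcis r t)) powr p) \<partial>lebesgue_on {0..<1})"

definition rho :: "real \<Rightarrow> ennreal \<Rightarrow> (complex \<Rightarrow> complex) \<Rightarrow> ennreal" where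
  "rho p q h =
    (if q = top
     then esssup (lebesgue_on {0..<2 * pi}) (\<lambda>t. enn_powr (radial_int p h t) (1 / p))
     else enn_powr
            (ennreal (1 / (2 * pi)) *
              (\<integral>\<^sup>+ t. enn_powr (radial_int p h t) (enn2real q / p) \<partial>lebesgue_on {0..2 * pi}))
            (1 / enn2real q))"

definition RM :: "real \<Rightarrow> ennreal \<Rightarrow> (complex \<Rightarrow> complex) set" where
  "RM p q = {f. f holomorphic_on ball 0 1 \<and> rho p q f < top}"

end

theory Submission
  imports Defs "HOL-Complex_Analysis.Cauchy_Integral_Formula"
begin

text \<open>
  Along a ray, \<open>\<bar>f\<bar>\<close> is dominated by \<open>G r = A + \<integral>\<^sub>0\<^sup>r \<bar>f'\<bar>\<close> for any \<open>A > \<bar>f 0\<bar>\<close>. Integrating the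
  derivative of \<open>(1 - r) G\<^sup>p\<close> over \<open>[0, R]\<close> and discarding the nonnegative boundary term at \<open>R\<close> gives
  \<open>\<integral>G\<^sup>p \<le> A\<^sup>p + p \<integral>(1 - r) G' G\<^sup>p\<^sup>-\<^sup>1\<close>; by Young's inequality (in place of Hoelder's) the norm \<open>X\<close> of \<open>G\<close>
  satisfies \<open>X\<^sup>p \<le> A\<^sup>p + p Y X\<^sup>p\<^sup>-\<^sup>1\<close> with \<open>Y\<close> the norm of \<open>(1 - r) f'\<close>, so \<open>X \<le> A + p Y\<close>. Letting \<open>R \<rightarrow> 1\<close> and
  \<open>A \<rightarrow> \<bar>f 0\<bar>\<close> proves the inequality on each ray, and Minkowski's inequality with a constant summand
  gives it for the \<open>L\<^sup>q\<close> norm in the angle.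
\<close>

section \<open>Real powers on the extended half-line\<close>

lemma enn_powr_mono: "0 \<le> a \<Longrightarrow> x \<le> y \<Longrightarrow> enn_powr x a \<le> enn_powr y a"
  unfolding enn_powr_def
  by (auto simp: top_unique less_top intro!: ennreal_leI powr_mono2 enn2real_mono)

lemma enn_powr_powr: "enn_powr (enn_powr x a) b = enn_powr x (a * b)"
  unfolding enn_powr_def by (auto simp: powr_powr)

lemma enn_powr_one [simp]: "enn_powr x 1 = x"
  unfolding enn_powr_def by (auto simp: less_top)

lemma enn_powr_ennreal: "0 \<le> x \<Longrightarrow> enn_powr (ennreal x) a = ennreal (x powr a)"
  unfolding enn_powr_def by auto

lemma enn_powr_cmult:
  assumes "0 < c"
  shows "enn_powr (ennreal c * x) a = ennreal (c powr a) * enn_powr x a"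
  using assms
  by (cases x) (auto simp: enn_powr_def powr_mult ennreal_mult_top simp flip: ennreal_mult)

lemma measurable_enn_powr [measurable]: "(\<lambda>x. enn_powr x a) \<in> borel_measurable borel"
  unfolding enn_powr_def by measurable

section \<open>A Hardy-type inequality on a compact interval\<close>

text \<open>Young's inequality with weights \<open>(p - 1) / p\<close> and \<open>1 / p\<close>,
  applied to \<open>l * x powr p\<close> and \<open>l powr (1 - p) * w powr p\<close>, in whose
  weighted geometric mean the powers of \<open>l\<close> cancel. The free \<open>l\<close> can later
  be tuned to make the bound as sharp as Hoelder's.\<close>

lemma weighted_young:
  fixes p :: real
  assumes "1 \<le> p" "0 < l" "0 < x" "0 \<le> w"
  shows "p * (x powr (p - 1) * w) \<le> (p - 1) * (l * x powr p) + l powr (1 - p) * w powr p"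
proof (cases "w = 0")
  case True
  with assms show ?thesis by simp
next
  case False
  with assms have "0 < w" by simp
  let ?a = "l * x powr p" and ?b = "l powr (1 - p) * w powr p"
  have "?a powr ((p - 1) / p) * ?b powr (1 / p) \<le> (p - 1) / p * ?a + 1 / p * ?b"
    using assms \<open>0 < w\<close> by (intro Youngs_inequality_0) (auto simp: field_simps)
  moreover have "?a powr ((p - 1) / p) * ?b powr (1 / p)
      = (l powr ((p - 1) / p) * l powr ((1 - p) / p)) * (x powr (p - 1) * w)"
    using assms \<open>0 < w\<close> by (simp add: powr_mult powr_powr)
  moreover have "l powr ((p - 1) / p) * l powr ((1 - p) / p) = 1"
    using assms by (simp add: powr_add[symmetric] add_divide_distrib[symmetric])
  ultimately show ?thesis
    using assms by (simp add: field_simps)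
qed

text \<open>Continuity of \<open>v\<close> on the compact interval makes every integral a finite
  real. Positivity of \<open>A\<close> keeps the primitive away from 0, where real powers may fail
  to be differentiable, and \<open>0 < Y\<close> makes the Young parameter \<open>Y / X\<close>
  positive.\<close>

lemma hardy_primitive:
  fixes v :: "real \<Rightarrow> real"
  assumes p: "1 \<le> p" and R: "0 \<le> R" "R \<le> 1"
    and v: "continuous_on {0..R} v" "\<And>r. r \<in> {0..R} \<Longrightarrow> 0 \<le> v r"
    and A: "0 < A" and Y: "0 < Y"
    and bound: "integral {0..R} (\<lambda>r. ((1 - r) * v r) powr p) \<le> Y powr p"
  shows "integral {0..R} (\<lambda>r. (A + integral {0..r} v) powr p) \<le> (A + p * Y) powr p"
proof -
  define G where "G r = A + integral {0..r} v" for r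
  have G_pos: "0 < G r" if "r \<in> {0..R}" for r
  proof -
    have "0 \<le> integral {0..r} v"
      using that v by (intro integral_nonneg integrable_continuous_interval) (auto intro: continuous_on_subset)
    with A show ?thesis by (simp add: G_def)
  qed
  have G_deriv: "(G has_real_derivative v r) (at r within {0..R})" if "r \<in> {0..R}" for r
    unfolding G_def has_real_derivative_iff_has_vector_derivative
    using integral_has_vector_derivative[OF v(1) that]
    by (auto intro!: derivative_eq_intros)
  have G_cont: "continuous_on {0..R} G"
    using G_deriv by (meson DERIV_continuous continuous_on_eq_continuous_within)
  have powG_cont: "continuous_on {0..R} (\<lambda>r. G r powr a)" for a
    using G_cont G_pos by (intro continuous_intros) (auto simp: less_imp_neq[symmetric])
  define I where "I = integral {0..R} (\<lambda>r. G r powr p)"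
  define w where "w r = (1 - r) * v r" for r
  have w_nonneg: "0 \<le> w r" if "r \<in> {0..R}" for r
    using that v(2)[OF that] R by (simp add: w_def)
  have w_cont: "continuous_on {0..R} w"
    unfolding w_def by (intro continuous_intros v)
  have wp_cont: "continuous_on {0..R} (\<lambda>r. w r powr p)"
    using w_cont w_nonneg p by (intro continuous_on_powr' continuous_intros) auto
  have parts: "((\<lambda>r. p * (G r powr (p - 1) * w r) - G r powr p) has_integral
      ((1 - R) * G R powr p - (1 - 0) * G 0 powr p)) {0..R}"
    using R(1)
  proof (rule fundamental_theorem_of_calculus)
    fix r assume r: "r \<in> {0..R}"
    show "((\<lambda>r. (1 - r) * G r powr p) has_vector_derivative
        p * (G r powr (p - 1) * w r) - G r powr p) (at r within {0..R})"
      unfolding has_real_derivative_iff_has_vector_derivative[symmetric] w_def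
      by (rule derivative_eq_intros G_deriv[OF r] refl | use G_pos[OF r] in \<open>force simp: field_simps powr_diff\<close>)+
  qed
  \<comment> \<open>The right-hand side contains \<open>I\<close> itself, so \<open>l\<close> stays
    arbitrary until it can be chosen in terms of \<open>I\<close>.\<close>
  have le: "I \<le> A powr p + (p - 1) * l * I + l powr (1 - p) * Y powr p" if l: "0 < l" for l
  proof -
    have i: "(\<lambda>r. G r powr p) integrable_on {0..R}" "(\<lambda>r. w r powr p) integrable_on {0..R}"
      "(\<lambda>r. p * (G r powr (p - 1) * w r)) integrable_on {0..R}"
      using powG_cont wp_cont w_cont
      by (auto intro!: integrable_continuous_interval continuous_intros powG_cont)
    have "I = integral {0..R} (\<lambda>r. p * (G r powr (p - 1) * w r))
        - integral {0..R} (\<lambda>r. p * (G r powr (p - 1) * w r) - G r powr p)"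
      unfolding I_def using i by (subst Henstock_Kurzweil_Integration.integral_diff) auto
    \<comment> \<open>The boundary term at \<open>R\<close> is nonnegative because
      \<open>R \<le> 1\<close>; the one at 0 is \<open>A powr p\<close> because
      \<open>G 0 = A\<close>.\<close>
    also have "\<dots> \<le> integral {0..R} (\<lambda>r. p * (G r powr (p - 1) * w r)) + A powr p"
      using integral_unique[OF parts] R by (simp add: G_def)
    also have "integral {0..R} (\<lambda>r. p * (G r powr (p - 1) * w r))
        \<le> integral {0..R} (\<lambda>r. (p - 1) * (l * G r powr p) + l powr (1 - p) * w r powr p)"
      using i G_pos w_nonneg p l by (intro integral_le weighted_young integrable_add integrable_on_mult_right) auto
    also have "\<dots> = (p - 1) * (l * I) + l powr (1 - p) * integral {0..R} (\<lambda>r. w r powr p)"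
      unfolding I_def using i
      by (subst integral_add) (auto intro!: integrable_on_mult_right)
    also have "\<dots> \<le> (p - 1) * (l * I) + l powr (1 - p) * Y powr p"
      using bound by (intro add_left_mono mult_left_mono) (auto simp: w_def)
    finally show ?thesis by (simp add: algebra_simps)
  qed
  have "I \<le> (A + p * Y) powr p"
  proof (cases "I \<le> A powr p")
    case True
    also have "A powr p \<le> (A + p * Y) powr p" using p A Y by (intro powr_mono2) auto
    finally show ?thesis .
  next
    case False
    then have I: "A powr p < I" by simp
    have I0: "0 < I" using I by (rule le_less_trans[rotated]) simp
    define X where "X = I powr (1 / p)"
    have X: "0 < X" "X powr p = I"
      using I0 p by (auto simp: X_def powr_powr)
    \<comment> \<open>This allows \<open>A powr p\<close> to be replaced by \<open>A * Z\<close>, so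
      that \<open>Z\<close> becomes a common factor and cancels.\<close>
    have AX: "A < X"
    proof (rule ccontr)
      assume "\<not> A < X"
      then have "X powr p \<le> A powr p" using X p by (intro powr_mono2) auto
      with X I show False by simp
    qed
    define Z where "Z = X powr (p - 1)"
    have Z: "0 < Z" "X powr p = X * Z"
      using X by (auto simp: Z_def powr_diff)
    \<comment> \<open>The choice \<open>l = Y / X\<close> balances Young's inequality: its two terms
      become \<open>(p - 1) * Y * Z\<close> and \<open>Z * Y\<close>, with sum
      \<open>p * Y * Z\<close>.\<close>
    have YX: "(Y / X) powr (1 - p) * Y powr p = Z * Y"
      using X Y by (simp add: Z_def powr_divide powr_diff field_simps)
    have "A powr p = A * A powr (p - 1)" using A by (simp add: powr_diff)
    also have "\<dots> \<le> A * Z"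
      unfolding Z_def using A AX p by (intro mult_left_mono powr_mono2) auto
    finally have "A powr p \<le> A * Z" .
    moreover have "(p - 1) * (Y / X) * I = (p - 1) * Y * Z"
      unfolding X(2)[symmetric] Z(2) using X by simp
    ultimately have "X * Z \<le> A * Z + (p - 1) * Y * Z + Z * Y"
      using le[of "Y / X"] X Y Z YX by simp
    then have "X * Z \<le> (A + p * Y) * Z" by (simp add: algebra_simps)
    then have "X \<le> A + p * Y" using Z by simp
    then have "X powr p \<le> (A + p * Y) powr p" using X p by (intro powr_mono2) auto
    with X show ?thesis by simp
  qed
  then show ?thesis by (simp add: I_def G_def)
qed

section \<open>Minkowski's inequality with a constant summand\<close>

text \<open>Convexity of the \<open>q\<close>-th power: \<open>x + c\<close> is the average of
  \<open>x * (N + c) / N\<close> and \<open>N + c\<close> with weights \<open>N / (N + c)\<close>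
  and \<open>c / (N + c)\<close>. The bound is affine in \<open>x powr q\<close>, hence easy to
  integrate, and is an equality at \<open>x = N\<close>.\<close>

lemma powr_add_le:
  fixes q :: real
  assumes "1 \<le> q" "0 < N" "0 < c" "0 \<le> x"
  shows "(x + c) powr q \<le> (N + c) powr (q - 1) * (N powr (1 - q) * x powr q + c)"
proof (cases "x = 0")
  case True
  have "c powr q = c powr (q - 1) * c" using assms by (simp add: powr_diff)
  also have "\<dots> \<le> (N + c) powr (q - 1) * c"
    using assms by (intro mult_right_mono powr_mono2) auto
  finally show ?thesis using True assms by simp
next
  case False
  define s where "s = N + c"
  have s: "0 < s" "1 - N / s = c / s" "N < s" using assms by (auto simp: s_def field_simps)
  have "((1 - N / s) *\<^sub>R s + (N / s) *\<^sub>R (x * s / N)) powr q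
      \<le> (1 - N / s) * s powr q + N / s * (x * s / N) powr q"
    using s assms False by (intro convex_onD[OF powr_convex[OF assms(1)]]) auto
  moreover have "(1 - N / s) *\<^sub>R s + (N / s) *\<^sub>R (x * s / N) = x + c"
    unfolding s(2) using assms s by simp
  moreover have "(1 - N / s) * s powr q + N / s * (x * s / N) powr q
     = s powr (q - 1) * (N powr (1 - q) * x powr q + c)"
    unfolding s(2) using assms s(1) by (simp add: powr_divide powr_mult powr_diff field_simps)
  ultimately show ?thesis by (simp add: s_def)
qed

text \<open>The measure scaled by \<open>k\<close> has total mass 1, so integrating
  \<open>powr_add_le\<close> with \<open>N\<close> close to the norm of \<open>F\<close> bounds the
  scaled integral by the \<open>q\<close>-th power of a number close to the sum of that norm and
  \<open>c\<close>.\<close>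

lemma nn_integral_powr_add_const:
  fixes q :: real and k :: ennreal
  assumes q: "1 \<le> q" and k: "k * emeasure M (space M) = 1" and c: "0 \<le> c"
    and F [measurable]: "F \<in> borel_measurable M"
  shows "enn_powr (k * (\<integral>\<^sup>+ x. enn_powr (F x + ennreal c) q \<partial>M)) (1 / q)
    \<le> enn_powr (k * (\<integral>\<^sup>+ x. enn_powr (F x) q \<partial>M)) (1 / q) + ennreal c" (is "?L \<le> ?S + _")
proof (cases "?S = top")
  case False
  then obtain s where s: "0 \<le> s" "?S = ennreal s" by (cases ?S) auto
  have [measurable]: "(\<lambda>x. enn_powr (F x) q) \<in> borel_measurable M"
    by (rule measurable_compose[OF _ measurable_enn_powr]) measurable
  have Sq: "k * (\<integral>\<^sup>+ x. enn_powr (F x) q \<partial>M) = ennreal (s powr q)"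
  proof -
    have "enn_powr ?S q = k * (\<integral>\<^sup>+ x. enn_powr (F x) q \<partial>M)"
      using q by (simp add: enn_powr_powr)
    then show ?thesis using s by (simp add: enn_powr_ennreal)
  qed
  \<comment> \<open>Both \<open>s\<close> and \<open>c\<close> may vanish, whereas
    \<open>powr_add_le\<close> asks for positive parameters; they are enlarged to \<open>N\<close>
    and \<open>d\<close>, and the excess is removed at the end.\<close>
  have *: "?L \<le> ennreal (N + d)" if "s < N" "c < d" for N d
  proof -
    have pos: "0 < N" "0 < d" using that s c by auto
    define C where "C = (N + d) powr (q - 1)"
    define D where "D = N powr (1 - q)"
    have CD: "0 < C" "0 < D" using pos by (auto simp: C_def D_def)
    have pw: "enn_powr (F x + ennreal c) q \<le> ennreal C * (ennreal D * enn_powr (F x) q + ennreal d)" for x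
    proof (cases "F x")
      case (real y)
      have "(y + c) powr q \<le> (y + d) powr q" using real that c q by (intro powr_mono2) auto
      also have "\<dots> \<le> C * (D * y powr q + d)"
        unfolding C_def D_def using real pos q by (intro powr_add_le) auto
      finally show ?thesis
        using real CD pos c by (simp add: enn_powr_ennreal flip: ennreal_plus ennreal_mult)
    qed (use CD in \<open>simp add: enn_powr_def ennreal_mult_top\<close>)
    have "k * (\<integral>\<^sup>+ x. enn_powr (F x + ennreal c) q \<partial>M)
        \<le> k * (\<integral>\<^sup>+ x. ennreal C * (ennreal D * enn_powr (F x) q + ennreal d) \<partial>M)"
      by (intro mult_left_mono nn_integral_mono pw) auto
    also have "\<dots> = ennreal C * (ennreal D * (k * (\<integral>\<^sup>+ x. enn_powr (F x) q \<partial>M))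
        + ennreal d * (k * emeasure M (space M)))"
      by (simp add: nn_integral_cmult nn_integral_add ring_distribs mult_ac)
    also have "\<dots> = ennreal (C * (D * s powr q + d))"
      using CD pos by (simp add: Sq k flip: ennreal_plus ennreal_mult)
    also have "\<dots> \<le> ennreal ((N + d) powr q)"
    proof (rule ennreal_leI)
      have "D * s powr q \<le> D * N powr q"
        using CD that s q by (intro mult_left_mono powr_mono2) auto
      also have "\<dots> = N" using pos by (simp add: D_def flip: powr_add)
      finally have "C * (D * s powr q + d) \<le> C * (N + d)" using CD by simp
      also have "\<dots> = (N + d) powr q" using pos by (simp add: C_def powr_diff)
      finally show "C * (D * s powr q + d) \<le> (N + d) powr q" .
    qed
    finally have "?L \<le> enn_powr (ennreal ((N + d) powr q)) (1 / q)"
      using q by (intro enn_powr_mono) auto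
    also have "\<dots> = ennreal (N + d)"
      using pos q by (simp add: enn_powr_ennreal powr_powr)
    finally show ?thesis .
  qed
  show ?thesis
    unfolding s(2)
  proof (rule ennreal_le_epsilon)
    fix e :: real assume "0 < e"
    then show "?L \<le> ennreal s + ennreal c + ennreal e"
      using *[of "s + e / 2" "c + e / 2"] s c by (simp add: add_ac flip: ennreal_plus)
  qed
qed simp

section \<open>Radial integrals over \<open>lborel\<close> and their measurability\<close>

lemma nn_integral_lebesgue_on:
  assumes "A \<in> sets lebesgue"
  shows "(\<integral>\<^sup>+ x. f x \<partial>lebesgue_on A) = (\<integral>\<^sup>+ x. f x * indicator A x \<partial>lborel)"
  using assms by (subst nn_integral_restrict_space) (auto simp: nn_integral_completion)

lemma radial_int_eq:
  "radial_int p h t = (\<integral>\<^sup>+ r. ennreal (cmod (h (rcis r t)) powr p) * indicator {0..<1} r \<partial>lborel)"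
  unfolding radial_int_def by (rule nn_integral_lebesgue_on) auto

text \<open>By Tonelli, integrating a jointly Borel function over \<open>r\<close> leaves a Borel
  function of \<open>t\<close>.\<close>

lemma measurable_radial_int:
  assumes "continuous_on (ball 0 1) h"
  shows "radial_int p h \<in> borel_measurable lborel"
proof -
  \<comment> \<open>Extension by zero makes \<open>h\<close> Borel on the whole plane; for
    \<open>r\<close> in \<open>{0..<1}\<close> only values inside the disc enter, so the radial
    integral is unchanged.\<close>
  have "(\<lambda>z. indicator (ball 0 1) z *\<^sub>R h z) \<in> borel_measurable borel"
    using assms by (intro borel_measurable_continuous_on_indicator) auto
  note [measurable] = this
  have "(\<lambda>x. rcis (snd x) (fst x)) \<in> borel_measurable (borel \<Otimes>\<^sub>M borel)"
    unfolding borel_prod rcis_def cis_conv_exp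
    by (intro borel_measurable_continuous_onI continuous_intros)
  note [measurable] = this
  have "radial_int p h = (\<lambda>t. \<integral>\<^sup>+ r. ennreal (cmod (indicator (ball 0 1) (rcis r t) *\<^sub>R h (rcis r t)) powr p)
      * indicator {0..<1} r \<partial>lborel)"
    unfolding radial_int_eq by (intro ext nn_integral_cong) (auto split: split_indicator)
  also have "\<dots> \<in> borel_measurable lborel"
    by measurable
  finally show ?thesis .
qed

section \<open>The inequality on a single ray\<close>

text \<open>On \<open>{0..R}\<close> with \<open>R < 1\<close> the function \<open>v\<close>, the
  modulus of \<open>deriv f\<close> on the ray, is continuous up to the end point, so
  \<open>hardy_primitive\<close> applies. Strict bounds \<open>A > |f 0|\<close> and
  \<open>Y > s\<close> supply the positivity it asks for.\<close>

lemma radial_hardy: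
  assumes p: "1 \<le> p" and f: "f holomorphic_on ball 0 1"
  shows "enn_powr (radial_int p f t) (1 / p) \<le>
    ennreal p * enn_powr (radial_int p (\<lambda>z. deriv f z * complex_of_real (1 - cmod z)) t) (1 / p)
    + ennreal (cmod (f 0))" (is "?L \<le> ennreal p * ?S + _")
proof (cases "?S = top")
  case True
  then show ?thesis using p by (simp add: ennreal_mult_top)
next
  case False
  then obtain s where s: "0 \<le> s" "?S = ennreal s" by (cases ?S) auto
  define v where "v r = cmod (deriv f (rcis r t))" for r
  have f': "deriv f holomorphic_on ball 0 1" using f by (intro holomorphic_deriv) auto
  have ray: "continuous_on {0..R} (\<lambda>r. h (rcis r t))"
    if "h holomorphic_on ball 0 1" "R < 1" for h R
  proof (rule continuous_on_compose2[OF holomorphic_on_imp_continuous_on[OF that(1)]])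
    show "continuous_on {0..R} (\<lambda>r. rcis r t)"
      unfolding rcis_def by (intro continuous_intros)
    show "(\<lambda>r. rcis r t) ` {0..R} \<subseteq> ball 0 1" using that(2) by auto
  qed
  have v_cont: "continuous_on {0..R} v" if "R < 1" for R
    unfolding v_def by (intro continuous_on_norm ray f' that)
  have wp_int: "(\<integral>\<^sup>+ r. ennreal (((1 - r) * v r) powr p) * indicator {0..<1} r \<partial>lborel) = ennreal (s powr p)"
  proof -
    have "enn_powr ?S p = radial_int p (\<lambda>z. deriv f z * complex_of_real (1 - cmod z)) t"
      using p by (simp add: enn_powr_powr)
    also have "\<dots> = (\<integral>\<^sup>+ r. ennreal (((1 - r) * v r) powr p) * indicator {0..<1} r \<partial>lborel)"
      unfolding radial_int_eq v_def
      by (intro nn_integral_cong)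
         (auto simp: norm_mult mult.commute simp del: of_real_diff split: split_indicator)
    finally show ?thesis using s by (simp add: enn_powr_ennreal)
  qed
  \<comment> \<open>The ray has velocity \<open>cis t\<close> of modulus 1, so the integrand in the
    fundamental theorem of calculus has modulus exactly \<open>v\<close>.\<close>
  have growth: "cmod (f (rcis r t)) \<le> cmod (f 0) + integral {0..r} v" if "0 \<le> r" "r < 1" for r
  proof -
    have "((\<lambda>s. deriv f (rcis s t) * cis t) has_integral f (rcis r t) - f (rcis 0 t)) {0..r}"
      using that(1)
    proof (rule fundamental_theorem_of_calculus)
      fix x assume "x \<in> {0..r}"
      then have "(f has_field_derivative deriv f (rcis x t)) (at (rcis x t))"
        using f that by (intro holomorphic_derivI[of _ "ball 0 1"]) auto
      moreover have "((\<lambda>s. rcis s t) has_vector_derivative cis t) (at x within {0..r})"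
        unfolding rcis_def by (auto intro!: derivative_eq_intros)
      ultimately have "((\<lambda>s. f (rcis s t)) has_vector_derivative cis t * deriv f (rcis x t)) (at x within {0..r})"
        using field_vector_diff_chain_within[of "\<lambda>s. rcis s t" "cis t" x "{0..r}" f]
        by (auto simp: o_def intro: has_field_derivative_at_within)
      then show "((\<lambda>s. f (rcis s t)) has_vector_derivative deriv f (rcis x t) * cis t) (at x within {0..r})"
        by (simp only: mult.commute)
    qed
    note ftc = this[unfolded rcis_zero_mod]
    have i: "(\<lambda>s. deriv f (rcis s t) * cis t) integrable_on {0..r}"
      using ftc by (rule has_integral_integrable)
    have eq: "f (rcis r t) - f 0 = integral {0..r} (\<lambda>s. deriv f (rcis s t) * cis t)"
      using ftc by (rule integral_unique[symmetric])
    have "cmod (f (rcis r t) - f 0) \<le> integral {0..r} v"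
      unfolding eq using that
      by (intro integral_norm_bound_integral i integrable_continuous_interval v_cont)
         (auto simp: v_def norm_mult)
    then show ?thesis by norm
  qed
  have part: "(\<integral>\<^sup>+ r. ennreal (cmod (f (rcis r t)) powr p) * indicator {0..R} r \<partial>lborel)
      \<le> ennreal ((A + p * Y) powr p)"
    if R: "0 \<le> R" "R < 1" and A: "cmod (f 0) < A" and Y: "s < Y" for R A Y
  proof -
    have A0: "0 < A" "0 < Y" using A Y s by (auto intro: le_less_trans[OF norm_ge_zero])
    have vR: "continuous_on {0..R} v" using v_cont R by simp
    have G_nonneg: "0 \<le> integral {0..r} v" if "r \<in> {0..R}" for r
      by (rule integral_nonneg)
        (use that vR in \<open>auto intro!: integrable_continuous_interval continuous_on_subset[OF vR] simp: v_def\<close>)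
    have w_int: "((\<lambda>r. ((1 - r) * v r) powr p) has_integral integral {0..R} (\<lambda>r. ((1 - r) * v r) powr p)) {0..R}"
      using R p by (intro integrable_integral integrable_continuous_interval continuous_on_powr' continuous_intros vR)
        (auto simp: v_def)
    have "ennreal (integral {0..R} (\<lambda>r. ((1 - r) * v r) powr p))
        = (\<integral>\<^sup>+ r. ennreal (((1 - r) * v r) powr p) * indicator {0..R} r \<partial>lborel)"
      using w_int by (intro nn_integral_has_integral_lebesgue'[symmetric]) auto
    also have "\<dots> \<le> ennreal (s powr p)"
      unfolding wp_int[symmetric] using R by (intro nn_integral_mono) (auto split: split_indicator)
    also have "\<dots> \<le> ennreal (Y powr p)"
      using s Y p by (intro ennreal_leI powr_mono2) auto
    finally have "integral {0..R} (\<lambda>r. ((1 - r) * v r) powr p) \<le> Y powr p" by simp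
    then have H: "integral {0..R} (\<lambda>r. (A + integral {0..r} v) powr p) \<le> (A + p * Y) powr p"
      using p R vR A0 by (intro hardy_primitive) (auto simp: v_def)
    have "(\<integral>\<^sup>+ r. ennreal (cmod (f (rcis r t)) powr p) * indicator {0..R} r \<partial>lborel)
        \<le> (\<integral>\<^sup>+ r. ennreal ((A + integral {0..r} v) powr p) * indicator {0..R} r \<partial>lborel)"
      using growth A R p
      by (intro nn_integral_mono)
         (force intro!: ennreal_leI powr_mono2 split: split_indicator)
    also have "\<dots> = ennreal (integral {0..R} (\<lambda>r. (A + integral {0..r} v) powr p))"
    proof (intro nn_integral_has_integral_lebesgue' integrable_integral integrable_continuous_interval)
      have "continuous_on {0..R} (\<lambda>r. integral {0..r} v)"
        by (intro indefinite_integral_continuous_1 integrable_continuous_interval vR)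
      then show "continuous_on {0..R} (\<lambda>r. (A + integral {0..r} v) powr p)"
        using G_nonneg A0 p by (intro continuous_on_powr' continuous_intros) auto
    qed auto
    also have "\<dots> \<le> ennreal ((A + p * Y) powr p)" using H by (rule ennreal_leI)
    finally show ?thesis .
  qed
  have full: "radial_int p f t \<le> ennreal ((A + p * Y) powr p)"
    if A: "cmod (f 0) < A" and Y: "s < Y" for A Y
  proof -
    \<comment> \<open>Increasing from \<open>R 0 = 0\<close> towards 1 and always below 1: the
      compact intervals \<open>{0..R n}\<close> exhaust \<open>{0..<1}\<close>, and monotone
      convergence applies.\<close>
    define R where "R n = 1 - 1 / real (Suc n)" for n
    have R: "0 \<le> R n" "R n < 1" for n by (auto simp: R_def field_simps)
    have "incseq R" unfolding R_def by (intro incseq_SucI) (simp add: field_simps)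
    have "radial_int p f t = (\<integral>\<^sup>+ r. (SUP n. ennreal (cmod (f (rcis r t)) powr p) * indicator {0..R n} r) \<partial>lborel)"
      unfolding radial_int_eq
    proof (intro nn_integral_cong)
      fix r :: real
      show "ennreal (cmod (f (rcis r t)) powr p) * indicator {0..<1} r =
          (SUP n. ennreal (cmod (f (rcis r t)) powr p) * indicator {0..R n} r)"
      proof (cases "r \<in> {0..<1}")
        case True
        then obtain n where "inverse (real (Suc n)) < 1 - r"
          using reals_Archimedean[of "1 - r"] by auto
        then have "r \<in> {0..R n}" using True by (auto simp: R_def inverse_eq_divide)
        then show ?thesis
          using True by (intro antisym SUP_upper2[of n] SUP_least) (auto split: split_indicator)
      next
        case False
        then have "r \<notin> {0..R n}" for n using R(2)[of n] by auto
        then show ?thesis using False by simp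
      qed
    qed
    also have "\<dots> = (SUP n. \<integral>\<^sup>+ r. ennreal (cmod (f (rcis r t)) powr p) * indicator {0..R n} r \<partial>lborel)"
    proof (rule nn_integral_monotone_convergence_SUP)
      show "incseq (\<lambda>n r. ennreal (cmod (f (rcis r t)) powr p) * indicator {0..R n} r)"
        using \<open>incseq R\<close>
        by (auto simp: incseq_def le_fun_def intro!: mult_left_mono split: split_indicator intro: order_trans)
      fix n
      \<comment> \<open>Continuity of \<open>f\<close> along the ray is known only inside the disc,
        so \<open>f\<close> is cut off before the norm is taken; since \<open>0 powr p = 0\<close>,
        this equals multiplying by the indicator afterwards.\<close>
      have "(\<lambda>r. indicator {0..R n} r *\<^sub>R f (rcis r t)) \<in> borel_measurable borel"
        using ray[OF f R(2)[of n]] by (intro borel_measurable_continuous_on_indicator) auto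
      then have "(\<lambda>r. ennreal (cmod (indicator {0..R n} r *\<^sub>R f (rcis r t)) powr p)) \<in> borel_measurable borel"
        by measurable
      moreover have "(\<lambda>r. ennreal (cmod (indicator {0..R n} r *\<^sub>R f (rcis r t)) powr p))
          = (\<lambda>r. ennreal (cmod (f (rcis r t)) powr p) * indicator {0..R n} r)"
        by (auto simp: fun_eq_iff split: split_indicator)
      ultimately show "(\<lambda>r. ennreal (cmod (f (rcis r t)) powr p) * indicator {0..R n} r) \<in> borel_measurable lborel"
        by (simp only: measurable_lborel2)
    qed
    also have "\<dots> \<le> ennreal ((A + p * Y) powr p)"
      using R A Y by (intro SUP_least part) auto
    finally show ?thesis .
  qed
  show ?thesis
    unfolding s(2)
  proof (rule ennreal_le_epsilon)
    fix e :: real assume e: "0 < e"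
    define A where "A = cmod (f 0) + e / 2"
    \<comment> \<open>Dividing by \<open>p\<close> offsets the factor in \<open>p * Y\<close>, so
      that \<open>A\<close> and \<open>p * Y\<close> each contribute \<open>e / 2\<close>.\<close>
    define Y where "Y = s + e / (2 * p)"
    have AY: "0 < A" "0 < Y" "A + p * Y = p * s + cmod (f 0) + e"
      using e p s by (auto simp: A_def Y_def field_simps add_pos_nonneg add_nonneg_pos)
    have "?L \<le> enn_powr (ennreal ((A + p * Y) powr p)) (1 / p)"
      using e p by (intro enn_powr_mono full) (auto simp: A_def Y_def)
    also have "\<dots> = ennreal (A + p * Y)"
      using AY(1,2) p by (simp add: enn_powr_ennreal powr_powr)
    also have "\<dots> = ennreal p * ennreal s + ennreal (cmod (f 0)) + ennreal e"
      unfolding AY(3) using p s e by (simp flip: ennreal_plus ennreal_mult)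
    finally show "?L \<le> ennreal p * ennreal s + ennreal (cmod (f 0)) + ennreal e" .
  qed
qed

section \<open>From single rays to the norm in the angle\<close>

theorem proposition3p2:
  fixes p :: real and q :: ennreal and f :: "complex \<Rightarrow> complex"
  assumes "1 \<le> p" and "1 \<le> q" and "f \<in> RM p q"
  shows "rho p q f \<le>
    ennreal p * rho p q (\<lambda>z. deriv f z * complex_of_real (1 - cmod z)) + ennreal (cmod (f 0))"
proof -
  define g where "g = (\<lambda>z. deriv f z * complex_of_real (1 - cmod z))"
  define a where "a = (\<lambda>t. enn_powr (radial_int p f t) (1 / p))"
  define b where "b = (\<lambda>t. enn_powr (radial_int p g t) (1 / p))"
  have f: "f holomorphic_on ball 0 1" using assms(3) by (simp add: RM_def)
  then have "continuous_on (ball 0 1) g"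
    unfolding g_def
    by (intro continuous_intros holomorphic_on_imp_continuous_on[OF holomorphic_deriv]) auto
  \<comment> \<open>The set \<open>S\<close> is arbitrary because \<open>rho\<close> takes the
    essential supremum over \<open>{0..<2 * pi}\<close> but integrates over
    \<open>{0..2 * pi}\<close>.\<close>
  then have b_meas: "b \<in> borel_measurable (lebesgue_on S)" for S
    unfolding b_def
    by (intro measurable_restrict_space1 measurable_completion
        measurable_compose[OF measurable_radial_int measurable_enn_powr])
  have a_meas: "a \<in> borel_measurable (lebesgue_on S)" for S
    unfolding a_def
    by (intro measurable_restrict_space1 measurable_completion
        measurable_compose[OF measurable_radial_int measurable_enn_powr]
        holomorphic_on_imp_continuous_on f)
  have ab: "a t \<le> ennreal p * b t + ennreal (cmod (f 0))" for t
    unfolding a_def b_def g_def by (rule radial_hardy[OF assms(1) f])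
  show ?thesis
  proof (cases "q = top")
    case True
    let ?M = "lebesgue_on {0..<2 * pi}"
    have "esssup ?M a \<le> ennreal p * esssup ?M b + ennreal (cmod (f 0))"
    proof (rule esssup_I[OF a_meas])
      show "AE t in ?M. a t \<le> ennreal p * esssup ?M b + ennreal (cmod (f 0))"
        using esssup_AE[of b ?M]
        by eventually_elim (meson ab add_right_mono mult_left_mono order_trans zero_le)
    qed
    with True show ?thesis by (simp add: rho_def a_def b_def g_def)
  next
    case False
    define Q where "Q = enn2real q"
    have q: "q = ennreal Q" using False by (simp add: Q_def less_top)
    then have Q: "1 \<le> Q" using assms(2) by simp
    let ?M = "lebesgue_on {0..2 * pi}" and ?k = "ennreal (1 / (2 * pi))"
    \<comment> \<open>This rewrites the integrands in \<open>rho\<close> as \<open>Q\<close>-th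
      powers of \<open>a\<close> and \<open>b\<close>, the form needed for Minkowski's
      inequality.\<close>
    have powr: "enn_powr x (Q / p) = enn_powr (enn_powr x (1 / p)) Q" for x
      by (simp add: enn_powr_powr)
    \<comment> \<open>The factor \<open>1 / (2 * pi)\<close> normalizes the angular measure, so the
      constant \<open>|f 0|\<close> passes through the norm with coefficient 1.\<close>
    have k: "?k * emeasure ?M (space ?M) = 1"
      by (simp add: emeasure_restrict_space flip: ennreal_mult)
    have bQ: "(\<lambda>t. enn_powr (b t) Q) \<in> borel_measurable ?M"
      by (rule measurable_compose[OF b_meas measurable_enn_powr])
    have pb: "(\<lambda>t. ennreal p * b t) \<in> borel_measurable ?M"
      using b_meas by measurable
    have "enn_powr (?k * (\<integral>\<^sup>+ t. enn_powr (a t) Q \<partial>?M)) (1 / Q)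
        \<le> enn_powr (?k * (\<integral>\<^sup>+ t. enn_powr (ennreal p * b t + ennreal (cmod (f 0))) Q \<partial>?M)) (1 / Q)"
      using Q by (intro enn_powr_mono mult_left_mono nn_integral_mono ab) auto
    also have "\<dots> \<le> enn_powr (?k * (\<integral>\<^sup>+ t. enn_powr (ennreal p * b t) Q \<partial>?M)) (1 / Q) + ennreal (cmod (f 0))"
      by (intro nn_integral_powr_add_const Q k pb) auto
    also have "?k * (\<integral>\<^sup>+ t. enn_powr (ennreal p * b t) Q \<partial>?M)
        = ennreal (p powr Q) * (?k * (\<integral>\<^sup>+ t. enn_powr (b t) Q \<partial>?M))"
      using assms(1) bQ by (simp add: enn_powr_cmult nn_integral_cmult mult.left_commute)
    also have "enn_powr \<dots> (1 / Q) = ennreal p * enn_powr (?k * (\<integral>\<^sup>+ t. enn_powr (b t) Q \<partial>?M)) (1 / Q)"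
      using assms(1) Q by (subst enn_powr_cmult) (auto simp: powr_powr)
    finally show ?thesis
      using False by (simp add: rho_def powr a_def b_def g_def flip: Q_def)
  qed
qed

end
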